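(* Let $k\geq 2$ and let $G$ be a graph with $\delta(G)\geq k-1$. If $d_{\times k}^{*}(G)\geq 3$, then $\gamma_{\times k}^{r}(G)=\gamma_{\times k}(G)$.
   Context: All graphs are finite, simple and undirected. For $G=(V,E)$ and $x\in V$, $N[x]$ is the closed neighborhood. For $\delta(G)\geq k-1$: $S\subseteq V$ is a $k$-tuple dominating set if $|N[x]\cap S|\geq k$ for all $x\in V$, and $\gamma_{\times k}(G)$ is the minimum cardinality of such a set; $S$ is a $k$-tuple restrained dominating set if moreover every vertex of $V-S$ has at least $k$ neighbors in $V-S$, and $\gamma_{\times k}^{r}(G)$ is the minimum cardinality of such a set. The star $k$-tuple domatic number $d_{\times k}^{*}(G)$ is the maximum number of classes of a partition of $V$ into $k$-tuple dominating sets of $G$ such that at least one class has cardinality $\gamma_{\times k}(G)$. *)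

theory Defs
  imports "Graph_Theory.Pair_Digraph" "HOL-Library.Disjoint_Sets"
begin

text \<open>
  Finite simple undirected graphs are the loopfree symmetric finite digraphs of
  \<^locale>\<open>pair_graph\<close>: an edge \<open>xy\<close> is the pair of arcs \<open>(x, y)\<close>, \<open>(y, x)\<close>.
\<close>

definition nbhd :: "'a pair_pre_digraph \<Rightarrow> 'a \<Rightarrow> 'a set" where
  "nbhd G x = {y. (x, y) \<in> parcs G}"

definition closed_nbhd :: "'a pair_pre_digraph \<Rightarrow> 'a \<Rightarrow> 'a set" where
  "closed_nbhd G x = insert x (nbhd G x)"

definition min_degree :: "'a pair_pre_digraph \<Rightarrow> nat" where
  "min_degree G = Min ((\<lambda>x. card (nbhd G x)) ` pverts G)"

definition ktuple_dominating :: "'a pair_pre_digraph \<Rightarrow> nat \<Rightarrow> 'a set \<Rightarrow> bool" where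
  "ktuple_dominating G k S \<longleftrightarrow>
     S \<subseteq> pverts G \<and> (\<forall>x\<in>pverts G. card (closed_nbhd G x \<inter> S) \<ge> k)"

definition ktuple_restrained_dominating :: "'a pair_pre_digraph \<Rightarrow> nat \<Rightarrow> 'a set \<Rightarrow> bool" where
  "ktuple_restrained_dominating G k S \<longleftrightarrow>
     ktuple_dominating G k S \<and>
     (\<forall>x\<in>pverts G - S. card (nbhd G x \<inter> (pverts G - S)) \<ge> k)"

text \<open>
  When the minimum degree is at least \<open>k - 1\<close>, the whole vertex set qualifies in both
  definitions below, so the minima range over finite nonempty sets.
\<close>

definition ktuple_domination_number :: "'a pair_pre_digraph \<Rightarrow> nat \<Rightarrow> nat" where
  "ktuple_domination_number G k = Min {card S |S. ktuple_dominating G k S}"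

definition ktuple_restrained_domination_number :: "'a pair_pre_digraph \<Rightarrow> nat \<Rightarrow> nat" where
  "ktuple_restrained_domination_number G k =
     Min {card S |S. ktuple_restrained_dominating G k S}"

definition star_ktuple_domatic_partition ::
    "'a pair_pre_digraph \<Rightarrow> nat \<Rightarrow> 'a set set \<Rightarrow> bool" where
  "star_ktuple_domatic_partition G k P \<longleftrightarrow>
     partition_on (pverts G) P \<and>
     (\<forall>S\<in>P. ktuple_dominating G k S) \<and>
     (\<exists>S\<in>P. card S = ktuple_domination_number G k)"

text \<open>
  A star \<open>k\<close>-tuple domatic partition need not exist (for instance, the triangle has none
  for \<open>k = 2\<close>). On a finite set of naturals \<^const>\<open>Sup\<close> is the maximum if the set is
  nonempty and 0 otherwise, so the number is 0 in that case, whereas \<^const>\<open>Max\<close> of the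
  empty set would be unspecified.
\<close>

definition star_ktuple_domatic_number :: "'a pair_pre_digraph \<Rightarrow> nat \<Rightarrow> nat" where
  "star_ktuple_domatic_number G k = Sup {card P |P. star_ktuple_domatic_partition G k P}"

end

theory Submission
  imports Defs
begin

text \<open>
  Let \<open>S\<close> be a class of minimum cardinality in a star partition with at least three classes.
  For a vertex \<open>x\<close> outside \<open>S\<close>, take a class \<open>U\<close> other than \<open>S\<close> and the class of \<open>x\<close>. As \<open>U\<close> is
  \<open>k\<close>-tuple dominating and does not contain \<open>x\<close>, it supplies \<open>k\<close> neighbors of \<open>x\<close> outside \<open>S\<close>.
  Hence \<open>S\<close> is already restrained.
\<close>

text \<open>If all these partitions had fewer than \<open>n\<close> classes, then
  \<open>n - 1\<close> would bound the supremum. Positivity of \<open>n\<close> makes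
  \<open>n \<le> n - 1\<close> absurd.\<close>

lemma star_ktuple_domatic_number_geE:
  assumes "n \<le> star_ktuple_domatic_number G k" "n > 0"
  obtains P where "star_ktuple_domatic_partition G k P" "n \<le> card P"
proof (rule ccontr)
  let ?A = "{card P |P. star_ktuple_domatic_partition G k P}"
  assume "\<not> thesis"
  then have less: "\<forall>a\<in>?A. a \<le> n - 1"
    using that \<open>n > 0\<close> by force
  have "Sup ?A \<le> n - 1"
  \<comment> \<open>\<open>cSup_least\<close> requires a nonempty set; without any star partition,
    the supremum is 0 by default.\<close>
  proof (cases "?A = {}")
    case True
    then show ?thesis by (simp only: Sup_nat_empty)
  next
    case False
    then show ?thesis using less by (intro cSup_least) blast+
  qed
  then show False
    using assms by (simp add: star_ktuple_domatic_number_def)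
qed

lemma partition_class_restrained:
  assumes fin: "finite (pverts G)"
    and P: "partition_on (pverts G) P" "\<forall>S\<in>P. ktuple_dominating G k S"
    and "3 \<le> card P" "S \<in> P"
  shows "ktuple_restrained_dominating G k S"
  unfolding ktuple_restrained_dominating_def
proof (intro conjI ballI)
  show "ktuple_dominating G k S" using assms by blast
  fix x assume x: "x \<in> pverts G - S"
  then obtain T where T: "T \<in> P" "x \<in> T"
    using partition_onD1[OF P(1)] by blast
  have "\<not> P \<subseteq> {S, T}"
  proof
    assume "P \<subseteq> {S, T}"
    then have "card P \<le> card {S, T}" by (intro card_mono) auto
    also have "\<dots> \<le> 2" by (simp add: card_insert_if)
    finally show False using \<open>3 \<le> card P\<close> by simp
  qed
  then obtain U where U: "U \<in> P" "U \<noteq> S" "U \<noteq> T" by blast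
  have disj: "U \<inter> S = {}" "U \<inter> T = {}"
    using partition_onD2[OF P(1)] U T \<open>S \<in> P\<close> by (auto dest: disjointD)
  have dom: "ktuple_dominating G k U" using P(2) U by blast
  then have k: "k \<le> card (closed_nbhd G x \<inter> U)"
    using x by (simp add: ktuple_dominating_def)
  \<comment> \<open>Since \<open>x\<close> lies in \<open>T\<close>, it is not in \<open>U\<close>,
    so the closed neighborhood can be replaced by the open one.\<close>
  have sub: "closed_nbhd G x \<inter> U \<subseteq> nbhd G x \<inter> (pverts G - S)"
    using disj T dom by (auto simp: closed_nbhd_def ktuple_dominating_def)
  show "k \<le> card (nbhd G x \<inter> (pverts G - S))"
    using k card_mono[OF _ sub] fin by fastforce
qed

theorem theorem4p7:
  fixes G :: "'a pair_pre_digraph" and k :: nat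
  assumes "k \<ge> 2"
    and "pair_graph G"
    and "pverts G \<noteq> {}"
    and "min_degree G \<ge> k - 1"
    and "star_ktuple_domatic_number G k \<ge> 3"
  shows "ktuple_restrained_domination_number G k = ktuple_domination_number G k"
proof -
  interpret pair_graph G by fact
  let ?D = "{card S |S. ktuple_dominating G k S}"
  let ?R = "{card S |S. ktuple_restrained_dominating G k S}"
  obtain P where P: "star_ktuple_domatic_partition G k P" "3 \<le> card P"
    using star_ktuple_domatic_number_geE[OF assms(5)] by auto
  then obtain S where S: "S \<in> P" "card S = Min ?D"
    by (auto simp: star_ktuple_domatic_partition_def ktuple_domination_number_def)
  have "ktuple_restrained_dominating G k S"
    using P S by (intro partition_class_restrained[of G P])
      (auto simp: star_ktuple_domatic_partition_def)
  \<comment> \<open>The star condition enters here: the minimum of \<open>?D\<close> is attained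
    within its subset \<open>?R\<close>, so both minima agree.\<close>
  then have mem: "Min ?D \<in> ?R" using S(2) by force
  have "?D \<subseteq> card ` Pow (pverts G)" by (auto simp: ktuple_dominating_def)
  then have fin: "finite ?D" by (rule finite_subset) simp
  have sub: "?R \<subseteq> ?D" by (auto simp: ktuple_restrained_dominating_def)
  have "Min ?R = Min ?D"
  proof (rule Min_eqI)
    show "finite ?R" using sub fin by (rule finite_subset)
    show "Min ?D \<le> a" if "a \<in> ?R" for a
      using fin sub that by (intro Min_le) blast+
  qed (fact mem)
  then show ?thesis
    by (simp add: ktuple_restrained_domination_number_def ktuple_domination_number_def)
qed

end
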